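(* Let $\mathcal{C}$ be a fusion category over $k$ and let $U(\mathcal{C})$ be its universal grading group, with universal grading $\mathcal{C} = \oplus_{g\in U(\mathcal{C})}\mathcal{C}_g$. Then: (i) If $X$ is a simple object of $\mathcal{C}$ and $g \in U(\mathcal{C})$ is such that $X \in \mathcal{C}_g$, then the order of $g$ divides the order of $X$. (ii) If $\mathcal{C}$ is generated as a fusion category by simple objects $X_1, \dots, X_m$, and $g_i \in U(\mathcal{C})$ is such that $X_i \in \mathcal{C}_{g_i}$, $1 \le i \le m$, then $g_1, \dots, g_m$ generate the group $U(\mathcal{C})$. In particular, if $X$ is a faithful simple object of $\mathcal{C}$, then the group $U(\mathcal{C})$ is cyclic and its order divides the order of $X$.
   Context: $k$ is an algebraically closed field of characteristic zero. A fusion category over $k$ is a $k$-linear semisimple rigid tensor category with finitely many isomorphism classes of simple objects, finite-dimensional Hom spaces and simple unit object $\mathbf{1}$. A fusion subcategory is a full tensor subcategory stable under direct sums and subobjects. The adjoint subcategory $\mathcal{C}_{\mathrm{ad}}$ is the fusion subcategory generated by $X \otimes X^*$, $X$ running over the simple objects of $\mathcal{C}$. A grading of $\mathcal{C}$ by a group $G$ is a decomposition $\mathcal{C} = \oplus_{g\in G}\mathcal{C}_g$ into full abelian subcategories with $\mathcal{C}_g^* = \mathcal{C}_{g^{-1}}$ and $\otimes$ mapping $\mathcal{C}_g\times \mathcal{C}_h$ to $\mathcal{C}_{gh}$; it is faithful if all $\mathcal{C}_g \neq 0$. Every fusion category has a canonical faithful grading, the universal grading, by a group $U(\mathcal{C})$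 (the universal grading group), with trivial component $\mathcal{C}_e = \mathcal{C}_{\mathrm{ad}}$; every grading of $\mathcal{C}$ by a group $G$ is obtained from it through a unique group homomorphism $U(\mathcal{C}) \to G$. The order of a nonzero object $X$ is the smallest integer $n \geq 1$ such that $\mathbf{1}$ occurs with positive multiplicity in $X^{\otimes n}$ (it always exists). An object $X$ is faithful if the fusion subcategory generated by $X$ is all of $\mathcal{C}$, equivalently every simple object occurs with positive multiplicity in $X^{\otimes n}$ for some $n \ge 1$. *)

theory Defs
  imports "HOL-Algebra.Algebra"
begin

no_notation var (\<open>X\<index>\<close>)  (* frees \<open>X\<close> for use as a variable *)

section \<open>Linear monoidal categories\<close>

text \<open>
  The Hom spaces are modules in the sense of \<^theory>\<open>HOL-Algebra.Module\<close> (the multiplicative part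
  of the record is unused). Composition is written in the usual order, \<open>g \<bullet> f\<close> being
  ``first \<open>f\<close>, then \<open>g\<close>''. Hom spaces are not required to be disjoint; operations on morphisms are
  only constrained on composable, well-typed arguments.
\<close>

record ('o, 'm, 'k) monoidal_data =
  Obj    :: "'o set"
  Hom    :: "'o \<Rightarrow> 'o \<Rightarrow> ('k, 'm) module"
  Id     :: "'o \<Rightarrow> 'm"
  Comp   :: "'m \<Rightarrow> 'm \<Rightarrow> 'm"  (infixr \<open>\<bullet>\<index>\<close> 65)
  Unit   :: "'o"
  Tens   :: "'o \<Rightarrow> 'o \<Rightarrow> 'o"  (infixl \<open>\<otimes>\<^sub>o\<index>\<close> 70)
  TensM  :: "'m \<Rightarrow> 'm \<Rightarrow> 'm"  (infixl \<open>\<otimes>\<^sub>m\<index>\<close> 70)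
  Assoc  :: "'o \<Rightarrow> 'o \<Rightarrow> 'o \<Rightarrow> 'm"
  LUnit  :: "'o \<Rightarrow> 'm"
  RUnit  :: "'o \<Rightarrow> 'm"

abbreviation mor :: "('o, 'm, 'k, 'x) monoidal_data_scheme \<Rightarrow> 'o \<Rightarrow> 'o \<Rightarrow> 'm set"
  where "mor C X Y \<equiv> carrier (Hom C X Y)"

locale linear_category = field K
  for K :: "'k ring" and C :: "('o, 'm, 'k) monoidal_data" +
  assumes Hom_module: "\<lbrakk>X \<in> Obj C; Y \<in> Obj C\<rbrakk> \<Longrightarrow> module K (Hom C X Y)"
    and Id_mor: "X \<in> Obj C \<Longrightarrow> Id C X \<in> mor C X X"
    and Comp_mor: "\<lbrakk>X \<in> Obj C; Y \<in> Obj C; Z \<in> Obj C; f \<in> mor C X Y; g \<in> mor C Y Z\<rbrakk>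
      \<Longrightarrow> g \<bullet>\<^bsub>C\<^esub> f \<in> mor C X Z"
    and Id_left: "\<lbrakk>X \<in> Obj C; Y \<in> Obj C; f \<in> mor C X Y\<rbrakk> \<Longrightarrow> Id C Y \<bullet>\<^bsub>C\<^esub> f = f"
    and Id_right: "\<lbrakk>X \<in> Obj C; Y \<in> Obj C; f \<in> mor C X Y\<rbrakk> \<Longrightarrow> f \<bullet>\<^bsub>C\<^esub> Id C X = f"
    and Comp_assoc: "\<lbrakk>W \<in> Obj C; X \<in> Obj C; Y \<in> Obj C; Z \<in> Obj C;
        f \<in> mor C W X; g \<in> mor C X Y; h \<in> mor C Y Z\<rbrakk>
      \<Longrightarrow> (h \<bullet>\<^bsub>C\<^esub> g) \<bullet>\<^bsub>C\<^esub> f = h \<bullet>\<^bsub>C\<^esub> (g \<bullet>\<^bsub>C\<^esub> f)"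
    and Comp_add_right: "\<lbrakk>X \<in> Obj C; Y \<in> Obj C; Z \<in> Obj C;
        f \<in> mor C X Y; f' \<in> mor C X Y; g \<in> mor C Y Z\<rbrakk>
      \<Longrightarrow> g \<bullet>\<^bsub>C\<^esub> (f \<oplus>\<^bsub>Hom C X Y\<^esub> f') = (g \<bullet>\<^bsub>C\<^esub> f) \<oplus>\<^bsub>Hom C X Z\<^esub> (g \<bullet>\<^bsub>C\<^esub> f')"
    and Comp_add_left: "\<lbrakk>X \<in> Obj C; Y \<in> Obj C; Z \<in> Obj C;
        f \<in> mor C X Y; g \<in> mor C Y Z; g' \<in> mor C Y Z\<rbrakk>
      \<Longrightarrow> (g \<oplus>\<^bsub>Hom C Y Z\<^esub> g') \<bullet>\<^bsub>C\<^esub> f = (g \<bullet>\<^bsub>C\<^esub> f) \<oplus>\<^bsub>Hom C X Z\<^esub> (g' \<bullet>\<^bsub>C\<^esub> f)"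
    and Comp_smult_right: "\<lbrakk>X \<in> Obj C; Y \<in> Obj C; Z \<in> Obj C; a \<in> carrier K;
        f \<in> mor C X Y; g \<in> mor C Y Z\<rbrakk>
      \<Longrightarrow> g \<bullet>\<^bsub>C\<^esub> (a \<odot>\<^bsub>Hom C X Y\<^esub> f) = a \<odot>\<^bsub>Hom C X Z\<^esub> (g \<bullet>\<^bsub>C\<^esub> f)"
    and Comp_smult_left: "\<lbrakk>X \<in> Obj C; Y \<in> Obj C; Z \<in> Obj C; a \<in> carrier K;
        f \<in> mor C X Y; g \<in> mor C Y Z\<rbrakk>
      \<Longrightarrow> (a \<odot>\<^bsub>Hom C Y Z\<^esub> g) \<bullet>\<^bsub>C\<^esub> f = a \<odot>\<^bsub>Hom C X Z\<^esub> (g \<bullet>\<^bsub>C\<^esub> f)"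

definition inverse_mors ::
    "('o, 'm, 'k) monoidal_data \<Rightarrow> 'o \<Rightarrow> 'o \<Rightarrow> 'm \<Rightarrow> 'm \<Rightarrow> bool"
  where "inverse_mors C X Y f g \<longleftrightarrow> X \<in> Obj C \<and> Y \<in> Obj C \<and> f \<in> mor C X Y \<and> g \<in> mor C Y X \<and>
    g \<bullet>\<^bsub>C\<^esub> f = Id C X \<and> f \<bullet>\<^bsub>C\<^esub> g = Id C Y"

definition iso_mor :: "('o, 'm, 'k) monoidal_data \<Rightarrow> 'o \<Rightarrow> 'o \<Rightarrow> 'm \<Rightarrow> bool"
  where "iso_mor C X Y f \<longleftrightarrow> (\<exists>g. inverse_mors C X Y f g)"

definition isomorphic :: "('o, 'm, 'k) monoidal_data \<Rightarrow> 'o \<Rightarrow> 'o \<Rightarrow> bool"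
  where "isomorphic C X Y \<longleftrightarrow> (\<exists>f. iso_mor C X Y f)"

definition mono_mor :: "('o, 'm, 'k) monoidal_data \<Rightarrow> 'o \<Rightarrow> 'o \<Rightarrow> 'm \<Rightarrow> bool"
  where "mono_mor C X Y f \<longleftrightarrow> X \<in> Obj C \<and> Y \<in> Obj C \<and> f \<in> mor C X Y \<and>
    (\<forall>W\<in>Obj C. \<forall>g\<in>mor C W X. \<forall>h\<in>mor C W X. f \<bullet>\<^bsub>C\<^esub> g = f \<bullet>\<^bsub>C\<^esub> h \<longrightarrow> g = h)"

definition epi_mor :: "('o, 'm, 'k) monoidal_data \<Rightarrow> 'o \<Rightarrow> 'o \<Rightarrow> 'm \<Rightarrow> bool"
  where "epi_mor C X Y f \<longleftrightarrow> X \<in> Obj C \<and> Y \<in> Obj C \<and> f \<in> mor C X Y \<and>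
    (\<forall>W\<in>Obj C. \<forall>g\<in>mor C Y W. \<forall>h\<in>mor C Y W. g \<bullet>\<^bsub>C\<^esub> f = h \<bullet>\<^bsub>C\<^esub> f \<longrightarrow> g = h)"

text \<open>\<open>is_kernel C A X Y i f\<close>: the morphism \<open>i : A \<rightarrow> X\<close> is a kernel of \<open>f : X \<rightarrow> Y\<close>.\<close>

definition is_kernel :: "('o, 'm, 'k) monoidal_data \<Rightarrow> 'o \<Rightarrow> 'o \<Rightarrow> 'o \<Rightarrow> 'm \<Rightarrow> 'm \<Rightarrow> bool"
  where "is_kernel C A X Y i f \<longleftrightarrow> A \<in> Obj C \<and> X \<in> Obj C \<and> Y \<in> Obj C \<and>
    i \<in> mor C A X \<and> f \<in> mor C X Y \<and> f \<bullet>\<^bsub>C\<^esub> i = \<zero>\<^bsub>Hom C A Y\<^esub> \<and>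
    (\<forall>W\<in>Obj C. \<forall>g\<in>mor C W X. f \<bullet>\<^bsub>C\<^esub> g = \<zero>\<^bsub>Hom C W Y\<^esub> \<longrightarrow>
      (\<exists>!u. u \<in> mor C W A \<and> i \<bullet>\<^bsub>C\<^esub> u = g))"

text \<open>\<open>is_cokernel C X Y B f q\<close>: the morphism \<open>q : Y \<rightarrow> B\<close> is a cokernel of \<open>f : X \<rightarrow> Y\<close>.\<close>

definition is_cokernel :: "('o, 'm, 'k) monoidal_data \<Rightarrow> 'o \<Rightarrow> 'o \<Rightarrow> 'o \<Rightarrow> 'm \<Rightarrow> 'm \<Rightarrow> bool"
  where "is_cokernel C X Y B f q \<longleftrightarrow> X \<in> Obj C \<and> Y \<in> Obj C \<and> B \<in> Obj C \<and>
    f \<in> mor C X Y \<and> q \<in> mor C Y B \<and> q \<bullet>\<^bsub>C\<^esub> f = \<zero>\<^bsub>Hom C X B\<^esub> \<and>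
    (\<forall>W\<in>Obj C. \<forall>g\<in>mor C Y W. g \<bullet>\<^bsub>C\<^esub> f = \<zero>\<^bsub>Hom C X W\<^esub> \<longrightarrow>
      (\<exists>!u. u \<in> mor C B W \<and> u \<bullet>\<^bsub>C\<^esub> q = g))"

definition zero_object :: "('o, 'm, 'k) monoidal_data \<Rightarrow> 'o \<Rightarrow> bool"
  where "zero_object C X \<longleftrightarrow> X \<in> Obj C \<and> Id C X = \<zero>\<^bsub>Hom C X X\<^esub>"

text \<open>
  \<open>direct_sum C Y Zs\<close>: the object \<open>Y\<close> is a direct sum (biproduct) of the list of objects \<open>Zs\<close>. For the
  empty list this says that \<open>Y\<close> is a zero object, for a one-element list that \<open>Y\<close> is isomorphic to
  its entry.
\<close>

definition direct_sum :: "('o, 'm, 'k) monoidal_data \<Rightarrow> 'o \<Rightarrow> 'o list \<Rightarrow> bool"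
  where "direct_sum C Y Zs \<longleftrightarrow> Y \<in> Obj C \<and> set Zs \<subseteq> Obj C \<and>
    (\<exists>i p. (\<forall>j<length Zs. i j \<in> mor C (Zs ! j) Y \<and> p j \<in> mor C Y (Zs ! j)) \<and>
      (\<forall>j<length Zs. \<forall>l<length Zs.
        p l \<bullet>\<^bsub>C\<^esub> i j = (if j = l then Id C (Zs ! j) else \<zero>\<^bsub>Hom C (Zs ! j) (Zs ! l)\<^esub>)) \<and>
      Id C Y = (\<Oplus>\<^bsub>Hom C Y Y\<^esub>j\<in>{..<length Zs}. i j \<bullet>\<^bsub>C\<^esub> p j))"

locale abelian_linear_category = linear_category K C
  for K :: "'k ring" and C :: "('o, 'm, 'k) monoidal_data" +
  assumes direct_sum_exists: "set Zs \<subseteq> Obj C \<Longrightarrow> \<exists>Y. direct_sum C Y Zs"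
    and kernel_exists: "\<lbrakk>X \<in> Obj C; Y \<in> Obj C; f \<in> mor C X Y\<rbrakk> \<Longrightarrow> \<exists>A i. is_kernel C A X Y i f"
    and cokernel_exists: "\<lbrakk>X \<in> Obj C; Y \<in> Obj C; f \<in> mor C X Y\<rbrakk> \<Longrightarrow> \<exists>B q. is_cokernel C X Y B f q"
    and mono_is_kernel: "mono_mor C A X i \<Longrightarrow> \<exists>Y f. is_kernel C A X Y i f"
    and epi_is_cokernel: "epi_mor C Y B q \<Longrightarrow> \<exists>X f. is_cokernel C X Y B f q"

locale linear_monoidal_category = linear_category K C
  for K :: "'k ring" and C :: "('o, 'm, 'k) monoidal_data" +
  assumes Unit_Obj: "Unit C \<in> Obj C"
    and Tens_Obj: "\<lbrakk>X \<in> Obj C; Y \<in> Obj C\<rbrakk> \<Longrightarrow> X \<otimes>\<^sub>o\<^bsub>C\<^esub> Y \<in> Obj C"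
    and TensM_mor: "\<lbrakk>X \<in> Obj C; Y \<in> Obj C; X' \<in> Obj C; Y' \<in> Obj C; f \<in> mor C X Y; f' \<in> mor C X' Y'\<rbrakk>
      \<Longrightarrow> f \<otimes>\<^sub>m\<^bsub>C\<^esub> f' \<in> mor C (X \<otimes>\<^sub>o\<^bsub>C\<^esub> X') (Y \<otimes>\<^sub>o\<^bsub>C\<^esub> Y')"
    and TensM_Id: "\<lbrakk>X \<in> Obj C; Y \<in> Obj C\<rbrakk> \<Longrightarrow> Id C X \<otimes>\<^sub>m\<^bsub>C\<^esub> Id C Y = Id C (X \<otimes>\<^sub>o\<^bsub>C\<^esub> Y)"
    and TensM_Comp: "\<lbrakk>X \<in> Obj C; Y \<in> Obj C; Z \<in> Obj C; X' \<in> Obj C; Y' \<in> Obj C; Z' \<in> Obj C;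
        f \<in> mor C X Y; g \<in> mor C Y Z; f' \<in> mor C X' Y'; g' \<in> mor C Y' Z'\<rbrakk>
      \<Longrightarrow> (g \<otimes>\<^sub>m\<^bsub>C\<^esub> g') \<bullet>\<^bsub>C\<^esub> (f \<otimes>\<^sub>m\<^bsub>C\<^esub> f') = (g \<bullet>\<^bsub>C\<^esub> f) \<otimes>\<^sub>m\<^bsub>C\<^esub> (g' \<bullet>\<^bsub>C\<^esub> f')"
    and TensM_add_left: "\<lbrakk>X \<in> Obj C; Y \<in> Obj C; X' \<in> Obj C; Y' \<in> Obj C;
        f \<in> mor C X Y; g \<in> mor C X Y; f' \<in> mor C X' Y'\<rbrakk>
      \<Longrightarrow> (f \<oplus>\<^bsub>Hom C X Y\<^esub> g) \<otimes>\<^sub>m\<^bsub>C\<^esub> f' =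
        (f \<otimes>\<^sub>m\<^bsub>C\<^esub> f') \<oplus>\<^bsub>Hom C (X \<otimes>\<^sub>o\<^bsub>C\<^esub> X') (Y \<otimes>\<^sub>o\<^bsub>C\<^esub> Y')\<^esub> (g \<otimes>\<^sub>m\<^bsub>C\<^esub> f')"
    and TensM_add_right: "\<lbrakk>X \<in> Obj C; Y \<in> Obj C; X' \<in> Obj C; Y' \<in> Obj C;
        f \<in> mor C X Y; f' \<in> mor C X' Y'; g' \<in> mor C X' Y'\<rbrakk>
      \<Longrightarrow> f \<otimes>\<^sub>m\<^bsub>C\<^esub> (f' \<oplus>\<^bsub>Hom C X' Y'\<^esub> g') =
        (f \<otimes>\<^sub>m\<^bsub>C\<^esub> f') \<oplus>\<^bsub>Hom C (X \<otimes>\<^sub>o\<^bsub>C\<^esub> X') (Y \<otimes>\<^sub>o\<^bsub>C\<^esub> Y')\<^esub> (f \<otimes>\<^sub>m\<^bsub>C\<^esub> g')"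
    and TensM_smult_left: "\<lbrakk>X \<in> Obj C; Y \<in> Obj C; X' \<in> Obj C; Y' \<in> Obj C; a \<in> carrier K;
        f \<in> mor C X Y; f' \<in> mor C X' Y'\<rbrakk>
      \<Longrightarrow> (a \<odot>\<^bsub>Hom C X Y\<^esub> f) \<otimes>\<^sub>m\<^bsub>C\<^esub> f' =
        a \<odot>\<^bsub>Hom C (X \<otimes>\<^sub>o\<^bsub>C\<^esub> X') (Y \<otimes>\<^sub>o\<^bsub>C\<^esub> Y')\<^esub> (f \<otimes>\<^sub>m\<^bsub>C\<^esub> f')"
    and TensM_smult_right: "\<lbrakk>X \<in> Obj C; Y \<in> Obj C; X' \<in> Obj C; Y' \<in> Obj C; a \<in> carrier K;
        f \<in> mor C X Y; f' \<in> mor C X' Y'\<rbrakk>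
      \<Longrightarrow> f \<otimes>\<^sub>m\<^bsub>C\<^esub> (a \<odot>\<^bsub>Hom C X' Y'\<^esub> f') =
        a \<odot>\<^bsub>Hom C (X \<otimes>\<^sub>o\<^bsub>C\<^esub> X') (Y \<otimes>\<^sub>o\<^bsub>C\<^esub> Y')\<^esub> (f \<otimes>\<^sub>m\<^bsub>C\<^esub> f')"
    and Assoc_iso: "\<lbrakk>X \<in> Obj C; Y \<in> Obj C; Z \<in> Obj C\<rbrakk>
      \<Longrightarrow> iso_mor C ((X \<otimes>\<^sub>o\<^bsub>C\<^esub> Y) \<otimes>\<^sub>o\<^bsub>C\<^esub> Z) (X \<otimes>\<^sub>o\<^bsub>C\<^esub> (Y \<otimes>\<^sub>o\<^bsub>C\<^esub> Z)) (Assoc C X Y Z)"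
    and Assoc_natural: "\<lbrakk>X \<in> Obj C; Y \<in> Obj C; Z \<in> Obj C; X' \<in> Obj C; Y' \<in> Obj C; Z' \<in> Obj C;
        f \<in> mor C X X'; g \<in> mor C Y Y'; h \<in> mor C Z Z'\<rbrakk>
      \<Longrightarrow> Assoc C X' Y' Z' \<bullet>\<^bsub>C\<^esub> ((f \<otimes>\<^sub>m\<^bsub>C\<^esub> g) \<otimes>\<^sub>m\<^bsub>C\<^esub> h) =
        (f \<otimes>\<^sub>m\<^bsub>C\<^esub> (g \<otimes>\<^sub>m\<^bsub>C\<^esub> h)) \<bullet>\<^bsub>C\<^esub> Assoc C X Y Z"
    and LUnit_iso: "X \<in> Obj C \<Longrightarrow> iso_mor C (Unit C \<otimes>\<^sub>o\<^bsub>C\<^esub> X) X (LUnit C X)"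
    and LUnit_natural: "\<lbrakk>X \<in> Obj C; Y \<in> Obj C; f \<in> mor C X Y\<rbrakk>
      \<Longrightarrow> LUnit C Y \<bullet>\<^bsub>C\<^esub> (Id C (Unit C) \<otimes>\<^sub>m\<^bsub>C\<^esub> f) = f \<bullet>\<^bsub>C\<^esub> LUnit C X"
    and RUnit_iso: "X \<in> Obj C \<Longrightarrow> iso_mor C (X \<otimes>\<^sub>o\<^bsub>C\<^esub> Unit C) X (RUnit C X)"
    and RUnit_natural: "\<lbrakk>X \<in> Obj C; Y \<in> Obj C; f \<in> mor C X Y\<rbrakk>
      \<Longrightarrow> RUnit C Y \<bullet>\<^bsub>C\<^esub> (f \<otimes>\<^sub>m\<^bsub>C\<^esub> Id C (Unit C)) = f \<bullet>\<^bsub>C\<^esub> RUnit C X"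
    and pentagon: "\<lbrakk>W \<in> Obj C; X \<in> Obj C; Y \<in> Obj C; Z \<in> Obj C\<rbrakk>
      \<Longrightarrow> (Id C W \<otimes>\<^sub>m\<^bsub>C\<^esub> Assoc C X Y Z) \<bullet>\<^bsub>C\<^esub> Assoc C W (X \<otimes>\<^sub>o\<^bsub>C\<^esub> Y) Z \<bullet>\<^bsub>C\<^esub> (Assoc C W X Y \<otimes>\<^sub>m\<^bsub>C\<^esub> Id C Z) =
        Assoc C W X (Y \<otimes>\<^sub>o\<^bsub>C\<^esub> Z) \<bullet>\<^bsub>C\<^esub> Assoc C (W \<otimes>\<^sub>o\<^bsub>C\<^esub> X) Y Z"
    and triangle: "\<lbrakk>X \<in> Obj C; Y \<in> Obj C\<rbrakk>
      \<Longrightarrow> (Id C X \<otimes>\<^sub>m\<^bsub>C\<^esub> LUnit C Y) \<bullet>\<^bsub>C\<^esub> Assoc C X (Unit C) Y = RUnit C X \<otimes>\<^sub>m\<^bsub>C\<^esub> Id C Y"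

section \<open>Fusion categories\<close>

text \<open>
  \<open>left_dual C X D\<close>: the object \<open>D\<close> is a left dual \<open>X\<^sup>*\<close> of \<open>X\<close>, i.e. there are an evaluation
  \<open>ev : D \<otimes> X \<rightarrow> 1\<close> and a coevaluation \<open>coev : 1 \<rightarrow> X \<otimes> D\<close> satisfying the two zigzag identities.
  The identities are composed with the unit constraints so as not to mention the inverses of the
  latter; \<open>b\<close> is the inverse of the associativity constraint of \<open>D\<close>, \<open>X\<close>, \<open>D\<close>.
\<close>

definition left_dual :: "('o, 'm, 'k) monoidal_data \<Rightarrow> 'o \<Rightarrow> 'o \<Rightarrow> bool"
  where "left_dual C X D \<longleftrightarrow> X \<in> Obj C \<and> D \<in> Obj C \<and>
    (\<exists>ev coev b. ev \<in> mor C (D \<otimes>\<^sub>o\<^bsub>C\<^esub> X) (Unit C) \<and> coev \<in> mor C (Unit C) (X \<otimes>\<^sub>o\<^bsub>C\<^esub> D) \<and>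
      inverse_mors C ((D \<otimes>\<^sub>o\<^bsub>C\<^esub> X) \<otimes>\<^sub>o\<^bsub>C\<^esub> D) (D \<otimes>\<^sub>o\<^bsub>C\<^esub> (X \<otimes>\<^sub>o\<^bsub>C\<^esub> D)) (Assoc C D X D) b \<and>
      RUnit C X \<bullet>\<^bsub>C\<^esub> (Id C X \<otimes>\<^sub>m\<^bsub>C\<^esub> ev) \<bullet>\<^bsub>C\<^esub> Assoc C X D X \<bullet>\<^bsub>C\<^esub> (coev \<otimes>\<^sub>m\<^bsub>C\<^esub> Id C X) = LUnit C X \<and>
      LUnit C D \<bullet>\<^bsub>C\<^esub> (ev \<otimes>\<^sub>m\<^bsub>C\<^esub> Id C D) \<bullet>\<^bsub>C\<^esub> b \<bullet>\<^bsub>C\<^esub> (Id C D \<otimes>\<^sub>m\<^bsub>C\<^esub> coev) = RUnit C D)"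

definition simple_object :: "('o, 'm, 'k) monoidal_data \<Rightarrow> 'o \<Rightarrow> bool"
  where "simple_object C S \<longleftrightarrow> S \<in> Obj C \<and> \<not> zero_object C S \<and>
    (\<forall>W i. mono_mor C W S i \<longrightarrow> zero_object C W \<or> iso_mor C W S i)"

definition finite_dim :: "'k ring \<Rightarrow> ('k, 'm) module \<Rightarrow> bool"
  where "finite_dim K M \<longleftrightarrow> (\<exists>B. finite B \<and> B \<subseteq> carrier M \<and>
    (\<forall>x\<in>carrier M. \<exists>c\<in>B \<rightarrow> carrier K. x = (\<Oplus>\<^bsub>M\<^esub>b\<in>B. c b \<odot>\<^bsub>M\<^esub> b)))"

locale fusion_category = abelian_linear_category K C + linear_monoidal_category K C
  for K :: "'k ring" and C :: "('o, 'm, 'k) monoidal_data" +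
  assumes semisimple: "Y \<in> Obj C \<Longrightarrow> \<exists>Zs. (\<forall>Z\<in>set Zs. simple_object C Z) \<and> direct_sum C Y Zs"
    and rigid_left: "X \<in> Obj C \<Longrightarrow> \<exists>D. left_dual C X D"
    and rigid_right: "X \<in> Obj C \<Longrightarrow> \<exists>D. left_dual C D X"
    and finite_simples: "\<exists>F. finite F \<and> (\<forall>S. simple_object C S \<longrightarrow> (\<exists>T\<in>F. isomorphic C S T))"
    and finite_dim_Hom: "\<lbrakk>X \<in> Obj C; Y \<in> Obj C\<rbrakk> \<Longrightarrow> finite_dim K (Hom C X Y)"
    and simple_Unit: "simple_object C (Unit C)"

definition char_zero :: "'k ring \<Rightarrow> bool"
  where "char_zero K \<longleftrightarrow> (\<forall>n::nat. 0 < n \<longrightarrow> add_pow K n \<one>\<^bsub>K\<^esub> \<noteq> \<zero>\<^bsub>K\<^esub>)"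

text \<open>Full subcategories are represented by their sets of objects.\<close>

definition fusion_subcategory :: "('o, 'm, 'k) monoidal_data \<Rightarrow> 'o set \<Rightarrow> bool"
  where "fusion_subcategory C D \<longleftrightarrow> D \<subseteq> Obj C \<and> Unit C \<in> D \<and>
    (\<forall>X\<in>D. \<forall>Y\<in>D. X \<otimes>\<^sub>o\<^bsub>C\<^esub> Y \<in> D) \<and>
    (\<forall>Y Zs. set Zs \<subseteq> D \<and> direct_sum C Y Zs \<longrightarrow> Y \<in> D) \<and>
    (\<forall>X Y i. Y \<in> D \<and> mono_mor C X Y i \<longrightarrow> X \<in> D)"

definition fusion_generated :: "('o, 'm, 'k) monoidal_data \<Rightarrow> 'o set \<Rightarrow> 'o set"
  where "fusion_generated C A = fusion_subcategory C hull A"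

definition adjoint_subcategory :: "('o, 'm, 'k) monoidal_data \<Rightarrow> 'o set"
  where "adjoint_subcategory C =
    fusion_generated C {X \<otimes>\<^sub>o\<^bsub>C\<^esub> D |X D. simple_object C X \<and> left_dual C X D}"

definition faithful_object :: "('o, 'm, 'k) monoidal_data \<Rightarrow> 'o \<Rightarrow> bool"
  where "faithful_object C X \<longleftrightarrow> fusion_generated C {X} = Obj C"

primrec tensor_power :: "('o, 'm, 'k) monoidal_data \<Rightarrow> 'o \<Rightarrow> nat \<Rightarrow> 'o"
  where
    "tensor_power C X 0 = Unit C"
  | "tensor_power C X (Suc n) = tensor_power C X n \<otimes>\<^sub>o\<^bsub>C\<^esub> X"

text \<open>
  The multiplicity of the simple object \<open>S\<close> in \<open>Y\<close> is the number of summands isomorphic to \<open>S\<close> in a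
  decomposition of \<open>Y\<close> into simple objects; it does not depend on the decomposition (Krull--Schmidt).
\<close>

definition multiplicity :: "('o, 'm, 'k) monoidal_data \<Rightarrow> 'o \<Rightarrow> 'o \<Rightarrow> nat"
  where "multiplicity C S Y = (SOME n. \<exists>Zs. (\<forall>Z\<in>set Zs. simple_object C Z) \<and> direct_sum C Y Zs \<and>
    n = length (filter (\<lambda>Z. isomorphic C Z S) Zs))"

text \<open>
  For a nonzero object of a fusion category an exponent as below always exists, so that the value
  \<open>0\<close> (chosen as for the order of group elements in \<^theory>\<open>HOL-Algebra.Multiplicative_Group\<close>)
  does not occur there.
\<close>

definition object_order :: "('o, 'm, 'k) monoidal_data \<Rightarrow> 'o \<Rightarrow> nat"
  where "object_order C X =
    (if \<exists>n\<ge>1. multiplicity C (Unit C) (tensor_power C X n) > 0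
     then LEAST n. n \<ge> 1 \<and> multiplicity C (Unit C) (tensor_power C X n) > 0
     else 0)"

section \<open>Gradings\<close>

text \<open>Closure under isomorphism and the zero object are instances of closure under direct sums.\<close>

definition abelian_subcategory :: "('o, 'm, 'k) monoidal_data \<Rightarrow> 'o set \<Rightarrow> bool"
  where "abelian_subcategory C D \<longleftrightarrow> D \<subseteq> Obj C \<and>
    (\<forall>Y Zs. set Zs \<subseteq> D \<and> direct_sum C Y Zs \<longrightarrow> Y \<in> D) \<and>
    (\<forall>A X Y i f. X \<in> D \<and> Y \<in> D \<and> is_kernel C A X Y i f \<longrightarrow> A \<in> D) \<and>
    (\<forall>X Y B f q. X \<in> D \<and> Y \<in> D \<and> is_cokernel C X Y B f q \<longrightarrow> B \<in> D)"

text \<open>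
  The decomposition of \<open>C\<close> as the direct sum of the components \<open>c g\<close>: every object is a direct sum of
  homogeneous objects, and there are no nonzero morphisms between different components.
\<close>

definition grading :: "('o, 'm, 'k) monoidal_data \<Rightarrow> 'g monoid \<Rightarrow> ('g \<Rightarrow> 'o set) \<Rightarrow> bool"
  where "grading C G c \<longleftrightarrow> group G \<and>
    (\<forall>g\<in>carrier G. abelian_subcategory C (c g)) \<and>
    (\<forall>Y\<in>Obj C. \<exists>Zs. set Zs \<subseteq> (\<Union>g\<in>carrier G. c g) \<and> direct_sum C Y Zs) \<and>
    (\<forall>g\<in>carrier G. \<forall>h\<in>carrier G. g \<noteq> h \<longrightarrow>
      (\<forall>X\<in>c g. \<forall>Y\<in>c h. mor C X Y = {\<zero>\<^bsub>Hom C X Y\<^esub>})) \<and>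
    (\<forall>g\<in>carrier G. {D. \<exists>X\<in>c g. left_dual C X D} = c (inv\<^bsub>G\<^esub> g)) \<and>
    (\<forall>g\<in>carrier G. \<forall>h\<in>carrier G. \<forall>X\<in>c g. \<forall>Y\<in>c h. X \<otimes>\<^sub>o\<^bsub>C\<^esub> Y \<in> c (g \<otimes>\<^bsub>G\<^esub> h))"

definition faithful_grading :: "('o, 'm, 'k) monoidal_data \<Rightarrow> 'g monoid \<Rightarrow> ('g \<Rightarrow> 'o set) \<Rightarrow> bool"
  where "faithful_grading C G c \<longleftrightarrow> grading C G c \<and>
    (\<forall>g\<in>carrier G. \<exists>X\<in>c g. \<not> zero_object C X)"

text \<open>
  The grading obtained from \<open>c\<close> through \<open>\<phi> : U \<rightarrow> G\<close> has as component of degree \<open>x\<close> the direct sum of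
  the components \<open>c g\<close> with \<open>\<phi> g = x\<close>.
\<close>

definition push_grading ::
    "('o, 'm, 'k) monoidal_data \<Rightarrow> 'u monoid \<Rightarrow> ('u \<Rightarrow> 'o set) \<Rightarrow> ('u \<Rightarrow> 'g) \<Rightarrow> 'g \<Rightarrow> 'o set"
  where "push_grading C U c \<phi> x =
    {Y. \<exists>Zs. set Zs \<subseteq> (\<Union>g\<in>{g \<in> carrier U. \<phi> g = x}. c g) \<and> direct_sum C Y Zs}"

text \<open>
  \<open>U\<close> with \<open>c\<close> is the universal grading (unique up to isomorphism). HOL cannot quantify over groups
  with carriers in all types; carriers in \<^typ>\<open>nat\<close> are enough, since every grading of a fusion
  category is supported on a finite subgroup of the grading group.
\<close>

definition universal_grading :: "('o, 'm, 'k) monoidal_data \<Rightarrow> 'u monoid \<Rightarrow> ('u \<Rightarrow> 'o set) \<Rightarrow> bool"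
  where "universal_grading C U c \<longleftrightarrow> faithful_grading C U c \<and>
    c \<one>\<^bsub>U\<^esub> = adjoint_subcategory C \<and>
    (\<forall>(G :: nat monoid) d. grading C G d \<longrightarrow>
      (\<exists>\<phi>\<in>hom U G. (\<forall>x\<in>carrier G. d x = push_grading C U c \<phi> x) \<and>
        (\<forall>\<psi>\<in>hom U G. (\<forall>x\<in>carrier G. d x = push_grading C U c \<psi> x) \<longrightarrow>
          (\<forall>g\<in>carrier U. \<psi> g = \<phi> g))))"

end

theory Submission
  imports Defs
begin

text \<open>
  Everything rests on one fact about a grading: an object of degree \<open>g\<close> and an object of degree
  \<open>h \<noteq> g\<close> have no nonzero morphisms between them, while degrees multiply under tensor products.

  For the first part, the unit object has degree \<open>\<one>\<close> (\<open>Unit_degree\<close>), and the \<open>n\<close>-th tensor power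
  of \<open>X\<close> has degree \<open>g\<^sup>n\<close>. If the unit object occurs in that power, the inclusion of the summand
  is a nonzero morphism, so \<open>g\<^sup>n = \<one>\<close> and the order of \<open>g\<close> divides \<open>n\<close>.

  For the second part, let \<open>H\<close> be the subgroup generated by the \<open>g\<^sub>i\<close>. The objects all of whose
  homogeneous constituents have degree in \<open>H\<close> form a fusion subcategory
  (\<open>fusion_subcategory_supported\<close>) that contains the \<open>X\<^sub>i\<close>, hence is everything. A nonzero
  object of degree \<open>u \<notin> H\<close> does not lie in it, so by faithfulness \<open>H\<close> is the whole group.

  For the last part, a simple object is homogeneous (\<open>simple_object_homogeneous\<close>), so a faithful
  simple object has a degree \<open>g\<close>. By the second part \<open>g\<close> generates the group, whose order is then
  the order of \<open>g\<close>, and the first part applies.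
\<close>

section \<open>Direct sums in linear categories\<close>

lemma finsum_hom:
  assumes "abelian_group M" "abelian_group N"
    and h: "h \<in> hom (add_monoid M) (add_monoid N)"
    and "finite A" and "f \<in> A \<rightarrow> carrier M"
  shows "h (finsum M f A) = finsum N (\<lambda>x. h (f x)) A"
  using assms(4,5)
proof (induction A)
  interpret M: abelian_group M by fact
  interpret N: abelian_group N by fact
  case empty
  show ?case
    using hom_one[OF h M.a_group N.a_group] by simp
next
  interpret M: abelian_group M by fact
  interpret N: abelian_group N by fact
  case (insert a A)
  have h_add: "h (x \<oplus>\<^bsub>M\<^esub> y) = h x \<oplus>\<^bsub>N\<^esub> h y" if "x \<in> carrier M" "y \<in> carrier M" for x y
    using h that by (simp add: hom_def)
  have h_closed: "h x \<in> carrier N" if "x \<in> carrier M" for x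
    using h that by (auto simp: hom_def)
  have f: "f \<in> A \<rightarrow> carrier M" "f a \<in> carrier M"
    using insert.prems by auto
  have "h (finsum M f (insert a A)) = h (f a) \<oplus>\<^bsub>N\<^esub> h (finsum M f A)"
    using insert.hyps f by (simp add: h_add)
  also have "\<dots> = h (f a) \<oplus>\<^bsub>N\<^esub> finsum N (\<lambda>x. h (f x)) A"
    using insert.IH f by simp
  also have "\<dots> = finsum N (\<lambda>x. h (f x)) (insert a A)"
    by (rule N.finsum_insert[symmetric]) (use insert.hyps f h_closed in auto)
  finally show ?case .
qed

context linear_category
begin

lemma Hom_abelian_group: "\<lbrakk>X \<in> Obj C; Y \<in> Obj C\<rbrakk> \<Longrightarrow> abelian_group (Hom C X Y)"
  using Hom_module by (simp add: module_def)

lemma zero_mor: "\<lbrakk>X \<in> Obj C; Y \<in> Obj C\<rbrakk> \<Longrightarrow> \<zero>\<^bsub>Hom C X Y\<^esub> \<in> mor C X Y"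
  using Hom_abelian_group abelian_group.axioms(1) abelian_monoid.zero_closed by blast

lemma Comp_right_hom:
  assumes "X \<in> Obj C" "Y \<in> Obj C" "Z \<in> Obj C" "f \<in> mor C X Y"
  shows "(\<lambda>g. g \<bullet>\<^bsub>C\<^esub> f) \<in> hom (add_monoid (Hom C Y Z)) (add_monoid (Hom C X Z))"
  using assms by (auto simp: hom_def intro: Comp_mor Comp_add_left)

lemma Comp_left_hom:
  assumes "X \<in> Obj C" "Y \<in> Obj C" "Z \<in> Obj C" "g \<in> mor C Y Z"
  shows "(\<lambda>f. g \<bullet>\<^bsub>C\<^esub> f) \<in> hom (add_monoid (Hom C X Y)) (add_monoid (Hom C X Z))"
  using assms by (auto simp: hom_def intro: Comp_mor Comp_add_right)

lemma hom_zero: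
  assumes "h \<in> hom (add_monoid (Hom C X Y)) (add_monoid (Hom C Z W))"
    and "X \<in> Obj C" "Y \<in> Obj C" "Z \<in> Obj C" "W \<in> Obj C"
  shows "h \<zero>\<^bsub>Hom C X Y\<^esub> = \<zero>\<^bsub>Hom C Z W\<^esub>"
  using hom_one[OF assms(1)] Hom_abelian_group[THEN abelian_group.a_group] assms(2-) by fastforce

lemma Comp_zero_left:
  assumes "X \<in> Obj C" "Y \<in> Obj C" "Z \<in> Obj C" "f \<in> mor C X Y"
  shows "\<zero>\<^bsub>Hom C Y Z\<^esub> \<bullet>\<^bsub>C\<^esub> f = \<zero>\<^bsub>Hom C X Z\<^esub>"
  using hom_zero[OF Comp_right_hom] assms by blast

lemma Comp_zero_right:
  assumes "X \<in> Obj C" "Y \<in> Obj C" "Z \<in> Obj C" "g \<in> mor C Y Z"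
  shows "g \<bullet>\<^bsub>C\<^esub> \<zero>\<^bsub>Hom C X Y\<^esub> = \<zero>\<^bsub>Hom C X Z\<^esub>"
  using hom_zero[OF Comp_left_hom] assms by blast

lemma Hom_to_zero_object:
  assumes "X \<in> Obj C" "zero_object C Y"
  shows "mor C X Y = {\<zero>\<^bsub>Hom C X Y\<^esub>}"
proof -
  have Y: "Y \<in> Obj C" "Id C Y = \<zero>\<^bsub>Hom C Y Y\<^esub>"
    using assms(2) by (auto simp: zero_object_def)
  have "f = \<zero>\<^bsub>Hom C X Y\<^esub>" if "f \<in> mor C X Y" for f
    using Id_left[of X Y f] Comp_zero_left[of X Y Y f] that Y assms(1) by simp
  then show ?thesis
    using zero_mor Y assms(1) by blast
qed

lemma zero_object_direct_sum:
  assumes "zero_object C Y"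
  shows "direct_sum C Y []"
proof -
  have Y: "Y \<in> Obj C" "Id C Y = \<zero>\<^bsub>Hom C Y Y\<^esub>"
    using assms by (auto simp: zero_object_def)
  interpret M: abelian_group "Hom C Y Y"
    using Hom_abelian_group Y by blast
  show ?thesis
    using Y by (simp add: direct_sum_def)
qed

lemma isomorphic_direct_sum:
  assumes "isomorphic C Z Y"
  shows "direct_sum C Y [Z]"
proof -
  obtain f g where fg: "inverse_mors C Z Y f g"
    using assms by (auto simp: isomorphic_def iso_mor_def)
  then have Y: "Y \<in> Obj C" and Z: "Z \<in> Obj C" and f: "f \<in> mor C Z Y" and g: "g \<in> mor C Y Z"
    and gf: "g \<bullet>\<^bsub>C\<^esub> f = Id C Z" "f \<bullet>\<^bsub>C\<^esub> g = Id C Y"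
    by (auto simp: inverse_mors_def)
  interpret M: abelian_group "Hom C Y Y"
    using Hom_abelian_group Y by blast
  have "(\<Oplus>\<^bsub>Hom C Y Y\<^esub>j\<in>{..<length [Z]}. f \<bullet>\<^bsub>C\<^esub> g) = Id C Y"
    using Id_mor[OF Y] gf by (simp add: lessThan_Suc)
  then show ?thesis
    unfolding direct_sum_def using Y Z f g gf
    by (intro conjI exI[of _ "\<lambda>_. f"] exI[of _ "\<lambda>_. g"]) auto
qed

text \<open>Any morphism into a direct sum is the sum of its components.\<close>

lemma Hom_to_direct_sum_zero:
  assumes "direct_sum C Y Zs" "X \<in> Obj C"
    and zero: "\<And>Z. Z \<in> set Zs \<Longrightarrow> mor C X Z = {\<zero>\<^bsub>Hom C X Z\<^esub>}"
  shows "mor C X Y = {\<zero>\<^bsub>Hom C X Y\<^esub>}"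
proof -
  obtain i p where Y: "Y \<in> Obj C" and Zs: "set Zs \<subseteq> Obj C"
    and ip: "\<forall>j<length Zs. i j \<in> mor C (Zs ! j) Y \<and> p j \<in> mor C Y (Zs ! j)"
    and Id: "Id C Y = (\<Oplus>\<^bsub>Hom C Y Y\<^esub>j\<in>{..<length Zs}. i j \<bullet>\<^bsub>C\<^esub> p j)"
    using assms(1) unfolding direct_sum_def by blast
  have Z: "Zs ! j \<in> Obj C" if "j < length Zs" for j
    using Zs that by auto
  interpret M: abelian_group "Hom C X Y"
    using Hom_abelian_group assms(2) Y by blast
  have "f = \<zero>\<^bsub>Hom C X Y\<^esub>" if f: "f \<in> mor C X Y" for f
  proof -
    have component: "(i j \<bullet>\<^bsub>C\<^esub> p j) \<bullet>\<^bsub>C\<^esub> f = \<zero>\<^bsub>Hom C X Y\<^esub>" if j: "j < length Zs" for j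
    proof -
      have "p j \<bullet>\<^bsub>C\<^esub> f \<in> mor C X (Zs ! j)"
        using Comp_mor assms(2) Y Z[OF j] f ip j by blast
      then have "p j \<bullet>\<^bsub>C\<^esub> f = \<zero>\<^bsub>Hom C X (Zs ! j)\<^esub>"
        using zero[of "Zs ! j"] j by simp
      then show ?thesis
        using Comp_assoc[of X Y "Zs ! j" Y f "p j" "i j"] Comp_zero_right[of X "Zs ! j" Y "i j"]
          assms(2) Y Z[OF j] f ip j by simp
    qed
    have "f = Id C Y \<bullet>\<^bsub>C\<^esub> f"
      using Id_left assms(2) Y f by simp
    also have "\<dots> = (\<Oplus>\<^bsub>Hom C X Y\<^esub>j\<in>{..<length Zs}. (i j \<bullet>\<^bsub>C\<^esub> p j) \<bullet>\<^bsub>C\<^esub> f)"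
      unfolding Id
    proof (rule finsum_hom[OF _ _ Comp_right_hom])
      show "(\<lambda>j. i j \<bullet>\<^bsub>C\<^esub> p j) \<in> {..<length Zs} \<rightarrow> mor C Y Y"
        using Comp_mor Y Z ip by blast
    qed (use Hom_abelian_group assms(2) Y f in auto)
    also have "\<dots> = (\<Oplus>\<^bsub>Hom C X Y\<^esub>j\<in>{..<length Zs}. \<zero>\<^bsub>Hom C X Y\<^esub>)"
      using component by (intro M.finsum_cong') auto
    finally show ?thesis
      by simp
  qed
  then show ?thesis
    using M.zero_closed by blast
qed

text \<open>
  Each structure inclusion of a direct sum is split by the corresponding projection, hence a
  monomorphism, and it can vanish only if its source is a zero object.
\<close>

lemma direct_sum_inclusion:
  assumes "direct_sum C Y Zs" "Z \<in> set Zs"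
  obtains i where "mono_mor C Z Y i" "i = \<zero>\<^bsub>Hom C Z Y\<^esub> \<Longrightarrow> zero_object C Z"
proof -
  obtain i p where Y: "Y \<in> Obj C" and Zs: "set Zs \<subseteq> Obj C"
    and ip: "\<forall>j<length Zs. i j \<in> mor C (Zs ! j) Y \<and> p j \<in> mor C Y (Zs ! j)"
    and pi: "\<forall>j<length Zs. \<forall>l<length Zs.
        p l \<bullet>\<^bsub>C\<^esub> i j = (if j = l then Id C (Zs ! j) else \<zero>\<^bsub>Hom C (Zs ! j) (Zs ! l)\<^esub>)"
    using assms(1) unfolding direct_sum_def by blast
  obtain j where j: "j < length Zs" "Z = Zs ! j"
    using assms(2) by (auto simp: in_set_conv_nth)
  have Z: "Z \<in> Obj C"
    using assms(2) Zs by auto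
  have i: "i j \<in> mor C Z Y" and p: "p j \<in> mor C Y Z" and retract: "p j \<bullet>\<^bsub>C\<^esub> i j = Id C Z"
    using ip pi j by auto
  have cancel: "p j \<bullet>\<^bsub>C\<^esub> (i j \<bullet>\<^bsub>C\<^esub> g) = g" if "W \<in> Obj C" "g \<in> mor C W Z" for W g
    using Comp_assoc[OF that(1) Z Y Z that(2) i p] Id_left[OF that(1) Z that(2)] retract by simp
  have "mono_mor C Z Y (i j)"
    unfolding mono_mor_def using Z Y i cancel by metis
  moreover have "zero_object C Z" if "i j = \<zero>\<^bsub>Hom C Z Y\<^esub>"
    using Comp_zero_right[OF Z Y Z p] that retract Z by (simp add: zero_object_def)
  ultimately show thesis
    by (rule that)
qed

text \<open>
  Among the summands of a simple object there is a nonzero one; its inclusion is a monomorphism into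
  a simple object and therefore an isomorphism.
\<close>

lemma simple_direct_sum_isomorphic:
  assumes "simple_object C S" "direct_sum C S Zs"
  shows "\<exists>Z\<in>set Zs. isomorphic C Z S"
proof -
  have S: "S \<in> Obj C" "\<not> zero_object C S"
    using assms(1) by (auto simp: simple_object_def)
  have "\<not> (\<forall>Z\<in>set Zs. zero_object C Z)"
  proof
    assume "\<forall>Z\<in>set Zs. zero_object C Z"
    then have "mor C S S = {\<zero>\<^bsub>Hom C S S\<^esub>}"
      using Hom_to_direct_sum_zero[OF assms(2) S(1)] Hom_to_zero_object[OF S(1)] by blast
    then show False
      using Id_mor[OF S(1)] S by (simp add: zero_object_def)
  qed
  then obtain Z where Z: "Z \<in> set Zs" "\<not> zero_object C Z"
    by blast
  obtain i where "mono_mor C Z S i"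
    using direct_sum_inclusion[OF assms(2) Z(1)] by blast
  then have "iso_mor C Z S i"
    using assms(1) Z(2) by (auto simp: simple_object_def)
  then show ?thesis
    using Z(1) by (auto simp: isomorphic_def)
qed

end

section \<open>Tensor products of direct sums\<close>

context linear_monoidal_category
begin

lemma TensM_Id_right_hom:
  assumes "X \<in> Obj C" "Y \<in> Obj C" "W \<in> Obj C"
  shows "(\<lambda>f. f \<otimes>\<^sub>m\<^bsub>C\<^esub> Id C W) \<in>
    hom (add_monoid (Hom C X Y)) (add_monoid (Hom C (X \<otimes>\<^sub>o\<^bsub>C\<^esub> W) (Y \<otimes>\<^sub>o\<^bsub>C\<^esub> W)))"
  using assms Id_mor[OF assms(3)]
  by (simp add: hom_def Pi_def TensM_mor[of X Y W W] TensM_add_left[of X Y W W])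

lemma TensM_Id_left_hom:
  assumes "X \<in> Obj C" "Y \<in> Obj C" "W \<in> Obj C"
  shows "(\<lambda>f. Id C W \<otimes>\<^sub>m\<^bsub>C\<^esub> f) \<in>
    hom (add_monoid (Hom C X Y)) (add_monoid (Hom C (W \<otimes>\<^sub>o\<^bsub>C\<^esub> X) (W \<otimes>\<^sub>o\<^bsub>C\<^esub> Y)))"
  using assms Id_mor[OF assms(3)]
  by (simp add: hom_def Pi_def TensM_mor[of W W X Y] TensM_add_right[of W W X Y])

text \<open>
  Tensoring with a fixed object on either side is an additive functor, so both distributive laws are
  instances of the fact that additive functors preserve direct sums.
\<close>

lemma additive_functor_direct_sum:
  assumes sum: "direct_sum C Y Zs"
    and Obj: "\<And>X. X \<in> Obj C \<Longrightarrow> F X \<in> Obj C"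
    and hom: "\<And>X Y. \<lbrakk>X \<in> Obj C; Y \<in> Obj C\<rbrakk> \<Longrightarrow>
      T \<in> hom (add_monoid (Hom C X Y)) (add_monoid (Hom C (F X) (F Y)))"
    and Id: "\<And>X. X \<in> Obj C \<Longrightarrow> T (Id C X) = Id C (F X)"
    and Comp: "\<And>X Y Z f g. \<lbrakk>X \<in> Obj C; Y \<in> Obj C; Z \<in> Obj C; f \<in> mor C X Y; g \<in> mor C Y Z\<rbrakk> \<Longrightarrow>
      T (g \<bullet>\<^bsub>C\<^esub> f) = T g \<bullet>\<^bsub>C\<^esub> T f"
  shows "direct_sum C (F Y) (map F Zs)"
proof -
  obtain i p where Y: "Y \<in> Obj C" and Zs: "set Zs \<subseteq> Obj C"
    and ip: "\<forall>j<length Zs. i j \<in> mor C (Zs ! j) Y \<and> p j \<in> mor C Y (Zs ! j)"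
    and pi: "\<forall>j<length Zs. \<forall>l<length Zs.
        p l \<bullet>\<^bsub>C\<^esub> i j = (if j = l then Id C (Zs ! j) else \<zero>\<^bsub>Hom C (Zs ! j) (Zs ! l)\<^esub>)"
    and IdY: "Id C Y = (\<Oplus>\<^bsub>Hom C Y Y\<^esub>j\<in>{..<length Zs}. i j \<bullet>\<^bsub>C\<^esub> p j)"
    using sum unfolding direct_sum_def by blast
  have Z: "Zs ! j \<in> Obj C" if "j < length Zs" for j
    using Zs that by auto
  have T_mor: "T f \<in> mor C (F A) (F B)" if "A \<in> Obj C" "B \<in> Obj C" "f \<in> mor C A B" for A B f
    using hom[OF that(1,2)] that(3) by (auto simp: hom_def)
  have T_zero: "T \<zero>\<^bsub>Hom C A B\<^esub> = \<zero>\<^bsub>Hom C (F A) (F B)\<^esub>" if "A \<in> Obj C" "B \<in> Obj C" for A B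
    using hom_zero[OF hom[OF that]] that Obj by blast
  interpret M: abelian_group "Hom C (F Y) (F Y)"
    using Hom_abelian_group Obj Y by blast
  have "Id C (F Y) = T (\<Oplus>\<^bsub>Hom C Y Y\<^esub>j\<in>{..<length Zs}. i j \<bullet>\<^bsub>C\<^esub> p j)"
    using Id[OF Y] IdY by simp
  also have "\<dots> = (\<Oplus>\<^bsub>Hom C (F Y) (F Y)\<^esub>j\<in>{..<length Zs}. T (i j \<bullet>\<^bsub>C\<^esub> p j))"
  proof (rule finsum_hom[OF _ _ hom])
    show "(\<lambda>j. i j \<bullet>\<^bsub>C\<^esub> p j) \<in> {..<length Zs} \<rightarrow> mor C Y Y"
      using Comp_mor Y Z ip by blast
  qed (use Hom_abelian_group Obj Y in auto)
  also have "\<dots> = (\<Oplus>\<^bsub>Hom C (F Y) (F Y)\<^esub>j\<in>{..<length Zs}. T (i j) \<bullet>\<^bsub>C\<^esub> T (p j))"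
  proof (rule M.finsum_cong'[OF refl])
    show "(\<lambda>j. T (i j) \<bullet>\<^bsub>C\<^esub> T (p j)) \<in> {..<length Zs} \<rightarrow> mor C (F Y) (F Y)"
    proof
      fix j assume "j \<in> {..<length Zs}"
      then have j: "j < length Zs" by simp
      show "T (i j) \<bullet>\<^bsub>C\<^esub> T (p j) \<in> mor C (F Y) (F Y)"
        using Comp_mor[of "F Y" "F (Zs ! j)" "F Y"] Obj T_mor Y Z[OF j] ip j by blast
    qed
    show "T (i j \<bullet>\<^bsub>C\<^esub> p j) = T (i j) \<bullet>\<^bsub>C\<^esub> T (p j)" if "j \<in> {..<length Zs}" for j
      using Comp[of Y "Zs ! j" Y] Y Z ip that by blast
  qed
  finally have IdF: "Id C (F Y) =
    (\<Oplus>\<^bsub>Hom C (F Y) (F Y)\<^esub>j\<in>{..<length (map F Zs)}. T (i j) \<bullet>\<^bsub>C\<^esub> T (p j))"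
    by simp
  have "T (p l) \<bullet>\<^bsub>C\<^esub> T (i j) =
      (if j = l then Id C (F (Zs ! j)) else \<zero>\<^bsub>Hom C (F (Zs ! j)) (F (Zs ! l))\<^esub>)"
    if "j < length Zs" "l < length Zs" for j l
    using Comp[of "Zs ! j" Y "Zs ! l" "i j" "p l"] Y Z ip pi that Id T_zero by (auto split: if_splits)
  then show ?thesis
    unfolding direct_sum_def using Obj Y Z Zs ip T_mor IdF
    by (intro conjI exI[of _ "\<lambda>j. T (i j)"] exI[of _ "\<lambda>j. T (p j)"]) auto
qed

lemma direct_sum_Tens_right:
  assumes "direct_sum C Y Zs" "W \<in> Obj C"
  shows "direct_sum C (Y \<otimes>\<^sub>o\<^bsub>C\<^esub> W) (map (\<lambda>Z. Z \<otimes>\<^sub>o\<^bsub>C\<^esub> W) Zs)"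
proof (rule additive_functor_direct_sum[where T = "\<lambda>f. f \<otimes>\<^sub>m\<^bsub>C\<^esub> Id C W"])
  show "(g \<bullet>\<^bsub>C\<^esub> f) \<otimes>\<^sub>m\<^bsub>C\<^esub> Id C W = (g \<otimes>\<^sub>m\<^bsub>C\<^esub> Id C W) \<bullet>\<^bsub>C\<^esub> (f \<otimes>\<^sub>m\<^bsub>C\<^esub> Id C W)"
    if "X \<in> Obj C" "Y \<in> Obj C" "Z \<in> Obj C" "f \<in> mor C X Y" "g \<in> mor C Y Z" for X Y Z f g
    using TensM_Comp[of X Y Z W W W f g "Id C W" "Id C W"] that assms(2)
      Id_mor[OF assms(2)] Id_left[of W W "Id C W"] by simp
qed (use assms Tens_Obj TensM_Id TensM_Id_right_hom in auto)

lemma direct_sum_Tens_left: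
  assumes "direct_sum C Y Zs" "W \<in> Obj C"
  shows "direct_sum C (W \<otimes>\<^sub>o\<^bsub>C\<^esub> Y) (map (\<lambda>Z. W \<otimes>\<^sub>o\<^bsub>C\<^esub> Z) Zs)"
proof (rule additive_functor_direct_sum[where T = "\<lambda>f. Id C W \<otimes>\<^sub>m\<^bsub>C\<^esub> f"])
  show "Id C W \<otimes>\<^sub>m\<^bsub>C\<^esub> (g \<bullet>\<^bsub>C\<^esub> f) = (Id C W \<otimes>\<^sub>m\<^bsub>C\<^esub> g) \<bullet>\<^bsub>C\<^esub> (Id C W \<otimes>\<^sub>m\<^bsub>C\<^esub> f)"
    if "X \<in> Obj C" "Y \<in> Obj C" "Z \<in> Obj C" "f \<in> mor C X Y" "g \<in> mor C Y Z" for X Y Z f g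
    using TensM_Comp[of W W W X Y Z "Id C W" "Id C W" f g] that assms(2)
      Id_mor[OF assms(2)] Id_left[of W W "Id C W"] by simp
qed (use assms Tens_Obj TensM_Id TensM_Id_left_hom in auto)

end

section \<open>Degrees of objects in a graded fusion category\<close>

context fusion_category
begin

text \<open>
  The multiplicity is realised by some decomposition into simple objects. The inclusion of a summand
  isomorphic to \<open>S\<close> is nonzero, since a projection splits it, and stays nonzero when composed
  with the isomorphism from \<open>S\<close>.
\<close>

lemma multiplicity_pos_imp_Hom_nonzero:
  assumes "Y \<in> Obj C" "simple_object C S" "multiplicity C S Y > 0"
  shows "mor C S Y \<noteq> {\<zero>\<^bsub>Hom C S Y\<^esub>}"
proof
  assume zero: "mor C S Y = {\<zero>\<^bsub>Hom C S Y\<^esub>}"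
  let ?P = "\<lambda>n. \<exists>Zs. (\<forall>Z\<in>set Zs. simple_object C Z) \<and> direct_sum C Y Zs \<and>
    n = length (filter (\<lambda>Z. isomorphic C Z S) Zs)"
  have "\<exists>n. ?P n"
    using semisimple[OF assms(1)] by blast
  then have "?P (multiplicity C S Y)"
    unfolding multiplicity_def by (rule someI_ex)
  then obtain Zs where Zs: "\<forall>Z\<in>set Zs. simple_object C Z" "direct_sum C Y Zs"
    and "filter (\<lambda>Z. isomorphic C Z S) Zs \<noteq> []"
    using assms(3) by auto
  then obtain Z where Z: "Z \<in> set Zs" "isomorphic C Z S"
    by (auto simp: filter_empty_conv)
  then obtain f g where "inverse_mors C Z S f g"
    by (auto simp: isomorphic_def iso_mor_def)
  then have ZO: "Z \<in> Obj C" and SO: "S \<in> Obj C" and f: "f \<in> mor C Z S" and g: "g \<in> mor C S Z"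
    and gf: "g \<bullet>\<^bsub>C\<^esub> f = Id C Z"
    by (auto simp: inverse_mors_def)
  obtain i where mono: "mono_mor C Z Y i" and i0: "i = \<zero>\<^bsub>Hom C Z Y\<^esub> \<Longrightarrow> zero_object C Z"
    using direct_sum_inclusion[OF Zs(2) Z(1)] by blast
  then have i: "i \<in> mor C Z Y"
    by (simp add: mono_mor_def)
  have "i \<bullet>\<^bsub>C\<^esub> g = \<zero>\<^bsub>Hom C S Y\<^esub>"
    using Comp_mor[OF SO ZO assms(1) g i] zero by simp
  then have "\<zero>\<^bsub>Hom C S Y\<^esub> \<bullet>\<^bsub>C\<^esub> f = i"
    using Comp_assoc[OF ZO SO ZO assms(1) f g i] Id_right[OF ZO assms(1) i] gf by simp
  then have "zero_object C Z"
    using i0 Comp_zero_left[OF ZO SO assms(1) f] by simp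
  then show False
    using Zs(1) Z(1) by (auto simp: simple_object_def)
qed

lemma tensor_power_Obj: "X \<in> Obj C \<Longrightarrow> tensor_power C X n \<in> Obj C"
  by (induction n) (auto intro: Unit_Obj Tens_Obj)

end

locale graded_fusion_category = fusion_category K C
  for K :: "'k ring" and C :: "('o, 'm, 'k) monoidal_data" +
  fixes U :: "'u monoid" and c :: "'u \<Rightarrow> 'o set"
  assumes graded: "grading C U c"
begin

lemma grading_conditions:
  shows group_grading: "group U"
    and grading_abelian: "\<forall>g\<in>carrier U. abelian_subcategory C (c g)"
    and grading_decomposition:
      "\<forall>Y\<in>Obj C. \<exists>Zs. set Zs \<subseteq> (\<Union>g\<in>carrier U. c g) \<and> direct_sum C Y Zs"
    and grading_Hom: "\<forall>g\<in>carrier U. \<forall>h\<in>carrier U. g \<noteq> h \<longrightarrow>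
      (\<forall>X\<in>c g. \<forall>Y\<in>c h. mor C X Y = {\<zero>\<^bsub>Hom C X Y\<^esub>})"
    and grading_Tens: "\<forall>g\<in>carrier U. \<forall>h\<in>carrier U. \<forall>X\<in>c g. \<forall>Y\<in>c h.
      X \<otimes>\<^sub>o\<^bsub>C\<^esub> Y \<in> c (g \<otimes>\<^bsub>U\<^esub> h)"
  using graded unfolding grading_def by - (elim conjE, assumption)+

sublocale U: group U
  by (rule group_grading)

lemmas homogeneous_decomposition = grading_decomposition[rule_format]
  and component_Hom_zero = grading_Hom[rule_format]
  and component_Tens = grading_Tens[rule_format]

lemma component_Obj:
  assumes "g \<in> carrier U" "X \<in> c g"
  shows "X \<in> Obj C"
proof -
  have "c g \<subseteq> Obj C"
    using grading_abelian[rule_format, OF assms(1)] unfolding abelian_subcategory_def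
    by (rule conjunct1)
  then show ?thesis
    using assms(2) by (rule subsetD)
qed

lemma component_direct_sum:
  assumes "g \<in> carrier U" "set Zs \<subseteq> c g" "direct_sum C Y Zs"
  shows "Y \<in> c g"
proof -
  have "\<forall>Y Zs. set Zs \<subseteq> c g \<and> direct_sum C Y Zs \<longrightarrow> Y \<in> c g"
    using grading_abelian[rule_format, OF assms(1)] unfolding abelian_subcategory_def
    by - (elim conjE, assumption)
  then show ?thesis
    using assms(2,3) by blast
qed

lemma component_isomorphic: "\<lbrakk>g \<in> carrier U; Z \<in> c g; isomorphic C Z Y\<rbrakk> \<Longrightarrow> Y \<in> c g"
  using component_direct_sum[of g "[Z]" Y] isomorphic_direct_sum by simp

lemma zero_object_component: "\<lbrakk>g \<in> carrier U; zero_object C Y\<rbrakk> \<Longrightarrow> Y \<in> c g"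
  using component_direct_sum[of g "[]" Y] zero_object_direct_sum by simp

lemma degree_unique:
  assumes "g \<in> carrier U" "h \<in> carrier U" "X \<in> c g" "X \<in> c h" "\<not> zero_object C X"
  shows "g = h"
proof (rule ccontr)
  assume "g \<noteq> h"
  then have "mor C X X = {\<zero>\<^bsub>Hom C X X\<^esub>}"
    using component_Hom_zero[OF assms(1,2) _ assms(3,4)] by simp
  then show False
    using Id_mor[of X] component_Obj[OF assms(1,3)] assms(5) by (simp add: zero_object_def)
qed

lemma simple_object_homogeneous:
  assumes "simple_object C X"
  obtains g where "g \<in> carrier U" "X \<in> c g"
proof -
  have "X \<in> Obj C"
    using assms by (simp add: simple_object_def)
  then obtain Zs where "set Zs \<subseteq> (\<Union>g\<in>carrier U. c g)" "direct_sum C X Zs"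
    using homogeneous_decomposition by blast
  then obtain g Z where "g \<in> carrier U" "Z \<in> c g" "isomorphic C Z X"
    using simple_direct_sum_isomorphic[OF assms] by blast
  then show thesis
    using that component_isomorphic by blast
qed

text \<open>
  The unit object is simple, so it has some degree \<open>g\<close>. It is isomorphic to its tensor square, which
  has degree \<open>g\<^sup>2\<close>, so \<open>g\<close> is idempotent.
\<close>

lemma Unit_degree: "Unit C \<in> c \<one>\<^bsub>U\<^esub>"
proof -
  obtain g where g: "g \<in> carrier U" "Unit C \<in> c g"
    using simple_object_homogeneous[OF simple_Unit] .
  have "isomorphic C (Unit C \<otimes>\<^sub>o\<^bsub>C\<^esub> Unit C) (Unit C)"
    using LUnit_iso[OF Unit_Obj] by (auto simp: isomorphic_def)
  then have "Unit C \<in> c (g \<otimes>\<^bsub>U\<^esub> g)"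
    using component_isomorphic[OF _ component_Tens[OF g(1) g(1) g(2) g(2)]] g(1) by simp
  then have "g = g \<otimes>\<^bsub>U\<^esub> g"
    using degree_unique[of g "g \<otimes>\<^bsub>U\<^esub> g"] g simple_Unit by (simp add: simple_object_def)
  then have "g = \<one>\<^bsub>U\<^esub>"
    using g(1) U.r_cancel_one[of g g] by simp
  then show ?thesis
    using g(2) by simp
qed

lemma tensor_power_degree:
  assumes "g \<in> carrier U" "X \<in> c g"
  shows "tensor_power C X n \<in> c (g [^]\<^bsub>U\<^esub> n)"
proof (induction n)
  case 0
  show ?case
    using Unit_degree by simp
next
  case (Suc n)
  show ?case
    using component_Tens[OF _ assms(1) Suc assms(2)] assms(1) by simp
qed

text \<open>
  The unit object, of degree \<open>\<one>\<close>, has a nonzero morphism to the power of \<open>X\<close> in which it occurs.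
  If no tensor power of \<open>X\<close> contains the unit object, the order of \<open>X\<close> is \<open>0\<close> by convention and
  divisibility is automatic.
\<close>

lemma ord_degree_dvd_object_order:
  assumes "g \<in> carrier U" "X \<in> c g"
  shows "U.ord g dvd object_order C X"
proof (cases "\<exists>n. n \<ge> 1 \<and> multiplicity C (Unit C) (tensor_power C X n) > 0")
  case False
  then have "object_order C X = 0"
    unfolding object_order_def by (rule if_not_P)
  then show ?thesis
    by simp
next
  case True
  define n where "n = object_order C X"
  have "n = (LEAST n. n \<ge> 1 \<and> multiplicity C (Unit C) (tensor_power C X n) > 0)"
    unfolding n_def object_order_def using True by (rule if_P)
  then have "n \<ge> 1 \<and> multiplicity C (Unit C) (tensor_power C X n) > 0"
    using LeastI_ex[OF True] by (simp only:)
  then have "mor C (Unit C) (tensor_power C X n) \<noteq> {\<zero>\<^bsub>Hom C (Unit C) (tensor_power C X n)\<^esub>}"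
    using multiplicity_pos_imp_Hom_nonzero[OF tensor_power_Obj[OF component_Obj[OF assms]] simple_Unit]
    by simp
  then have "\<one>\<^bsub>U\<^esub> = g [^]\<^bsub>U\<^esub> n"
    using component_Hom_zero[OF U.one_closed U.nat_pow_closed[OF assms(1)] _ Unit_degree
      tensor_power_degree[OF assms], of n] by argo
  then show ?thesis
    using U.pow_eq_id[OF assms(1), of n] by (simp add: n_def)
qed

section \<open>Subgroups and fusion subcategories\<close>

text \<open>
  The objects whose homogeneous constituents all have degree in \<open>H\<close>. Expressing this by the
  vanishing of morphisms from the other components avoids choosing a decomposition and makes the
  closure under subobjects and direct sums immediate.
\<close>

definition supported :: "'u set \<Rightarrow> 'o set"
  where "supported H = {Y \<in> Obj C. \<forall>u\<in>carrier U - H. \<forall>X\<in>c u. mor C X Y = {\<zero>\<^bsub>Hom C X Y\<^esub>}}"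

lemma component_subset_supported:
  assumes "H \<subseteq> carrier U" "h \<in> H"
  shows "c h \<subseteq> supported H"
proof
  fix Y assume Y: "Y \<in> c h"
  have h: "h \<in> carrier U"
    using assms by blast
  have "mor C X Y = {\<zero>\<^bsub>Hom C X Y\<^esub>}" if "u \<in> carrier U - H" "X \<in> c u" for u X
    by (rule component_Hom_zero[of u h]) (use h Y that assms(2) in auto)
  then show "Y \<in> supported H"
    using component_Obj[OF h Y] by (simp add: supported_def)
qed

lemma supported_direct_sum:
  assumes "set Zs \<subseteq> supported H" "direct_sum C Y Zs"
  shows "Y \<in> supported H"
proof -
  have "Y \<in> Obj C"
    using assms(2) by (simp add: direct_sum_def)
  moreover have "mor C X Y = {\<zero>\<^bsub>Hom C X Y\<^esub>}" if "u \<in> carrier U - H" "X \<in> c u" for u X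
  proof (rule Hom_to_direct_sum_zero[OF assms(2)])
    show "X \<in> Obj C"
      using component_Obj[of u X] that by simp
    show "mor C X Z = {\<zero>\<^bsub>Hom C X Z\<^esub>}" if "Z \<in> set Zs" for Z
      using subsetD[OF assms(1) that] \<open>u \<in> carrier U - H\<close> \<open>X \<in> c u\<close> by (simp add: supported_def)
  qed
  ultimately show ?thesis
    by (simp add: supported_def)
qed

lemma supported_subobject:
  assumes "Y \<in> supported H" "mono_mor C A Y i"
  shows "A \<in> supported H"
proof -
  have A: "A \<in> Obj C" and Y: "Y \<in> Obj C" and i: "i \<in> mor C A Y"
    and cancel: "\<And>W g h. \<lbrakk>W \<in> Obj C; g \<in> mor C W A; h \<in> mor C W A; i \<bullet>\<^bsub>C\<^esub> g = i \<bullet>\<^bsub>C\<^esub> h\<rbrakk> \<Longrightarrow> g = h"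
    using assms(2) unfolding mono_mor_def by blast+
  have "mor C X A = {\<zero>\<^bsub>Hom C X A\<^esub>}" if u: "u \<in> carrier U - H" "X \<in> c u" for u X
  proof -
    have X: "X \<in> Obj C"
      using component_Obj[of u] u by simp
    have XY: "mor C X Y = {\<zero>\<^bsub>Hom C X Y\<^esub>}"
      using assms(1) u unfolding supported_def by blast
    have "g = \<zero>\<^bsub>Hom C X A\<^esub>" if g: "g \<in> mor C X A" for g
    proof (rule cancel[OF X g zero_mor[OF X A]])
      show "i \<bullet>\<^bsub>C\<^esub> g = i \<bullet>\<^bsub>C\<^esub> \<zero>\<^bsub>Hom C X A\<^esub>"
        using Comp_mor[OF X A Y g i] Comp_zero_right[OF X A Y i] XY by simp
    qed
    then show ?thesis
      using zero_mor[OF X A] by blast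
  qed
  then show ?thesis
    using A by (simp add: supported_def)
qed

text \<open>
  In a homogeneous decomposition of a supported object, a summand of degree outside \<open>H\<close> has zero
  inclusion, so it is a zero object, and zero objects have every degree.
\<close>

lemma supported_decomposition:
  assumes "H \<subseteq> carrier U" "\<one>\<^bsub>U\<^esub> \<in> H" "Y \<in> supported H"
  obtains Zs where "set Zs \<subseteq> (\<Union>h\<in>H. c h)" "direct_sum C Y Zs"
proof -
  have "Y \<in> Obj C"
    using assms(3) by (simp add: supported_def)
  then obtain Zs where Zs: "set Zs \<subseteq> (\<Union>g\<in>carrier U. c g)" "direct_sum C Y Zs"
    using homogeneous_decomposition by blast
  have "Z \<in> (\<Union>h\<in>H. c h)" if Z: "Z \<in> set Zs" for Z
  proof -
    obtain g where g: "g \<in> carrier U" "Z \<in> c g"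
      using Zs(1) Z by blast
    show ?thesis
    proof (cases "g \<in> H")
      case True
      then show ?thesis
        using g by blast
    next
      case False
      obtain i where "mono_mor C Z Y i" "i = \<zero>\<^bsub>Hom C Z Y\<^esub> \<Longrightarrow> zero_object C Z"
        using direct_sum_inclusion[OF Zs(2) Z] by blast
      moreover have "mor C Z Y = {\<zero>\<^bsub>Hom C Z Y\<^esub>}"
        using assms(3) g False by (simp add: supported_def)
      ultimately have "zero_object C Z"
        by (simp add: mono_mor_def)
      then show ?thesis
        using zero_object_component[of "\<one>\<^bsub>U\<^esub>"] assms(2) by blast
    qed
  qed
  then show thesis
    using that Zs(2) by blast
qed

text \<open>
  By distributivity, a tensor product of two sums of homogeneous objects with degrees in \<open>H\<close> is a
  sum of tensor products of their summands, whose degrees are products of elements of \<open>H\<close>.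
\<close>

lemma supported_Tens:
  assumes "subgroup H U" "X \<in> supported H" "Y \<in> supported H"
  shows "X \<otimes>\<^sub>o\<^bsub>C\<^esub> Y \<in> supported H"
proof -
  interpret H: subgroup H U by fact
  have H: "H \<subseteq> carrier U"
    by (rule H.subset)
  obtain Ws where Ws: "set Ws \<subseteq> (\<Union>h\<in>H. c h)" "direct_sum C X Ws"
    using supported_decomposition[OF H H.one_closed assms(2)] .
  obtain Zs where Zs: "set Zs \<subseteq> (\<Union>h\<in>H. c h)" "direct_sum C Y Zs"
    using supported_decomposition[OF H H.one_closed assms(3)] .
  have Y: "Y \<in> Obj C"
    using assms(3) by (simp add: supported_def)
  have "W \<otimes>\<^sub>o\<^bsub>C\<^esub> Y \<in> supported H" if W: "W \<in> set Ws" for W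
  proof (rule supported_direct_sum)
    show "direct_sum C (W \<otimes>\<^sub>o\<^bsub>C\<^esub> Y) (map (\<lambda>Z. W \<otimes>\<^sub>o\<^bsub>C\<^esub> Z) Zs)"
    proof (rule direct_sum_Tens_left[OF Zs(2)])
      have "set Ws \<subseteq> Obj C"
        using Ws(2) by (simp add: direct_sum_def)
      then show "W \<in> Obj C"
        using W by (rule subsetD)
    qed
    have "W \<otimes>\<^sub>o\<^bsub>C\<^esub> Z \<in> supported H" if Z: "Z \<in> set Zs" for Z
    proof -
      obtain h k where hk: "h \<in> H" "W \<in> c h" "k \<in> H" "Z \<in> c k"
        using Ws(1) Zs(1) W Z by blast
      then have "W \<otimes>\<^sub>o\<^bsub>C\<^esub> Z \<in> c (h \<otimes>\<^bsub>U\<^esub> k)"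
        by (intro component_Tens) (use H in auto)
      then show ?thesis
        by (rule subsetD[OF component_subset_supported[OF H H.m_closed[OF hk(1,3)]]])
    qed
    then show "set (map (\<lambda>Z. W \<otimes>\<^sub>o\<^bsub>C\<^esub> Z) Zs) \<subseteq> supported H"
      by auto
  qed
  then have "set (map (\<lambda>W. W \<otimes>\<^sub>o\<^bsub>C\<^esub> Y) Ws) \<subseteq> supported H"
    by auto
  then show ?thesis
    using direct_sum_Tens_right[OF Ws(2) Y] by (rule supported_direct_sum)
qed

lemma fusion_subcategory_supported:
  assumes "subgroup H U"
  shows "fusion_subcategory C (supported H)"
proof -
  have "Unit C \<in> supported H"
    using component_subset_supported[OF subgroup.subset[OF assms] subgroup.one_closed[OF assms]]
      Unit_degree by auto
  moreover have "supported H \<subseteq> Obj C"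
    by (auto simp: supported_def)
  ultimately show ?thesis
    unfolding fusion_subcategory_def
    using supported_Tens[OF assms] supported_direct_sum[of _ H] supported_subobject[of _ H]
    by (intro conjI) (assumption | blast)+
qed

text \<open>
  A nonzero object of degree outside the generated subgroup would be supported on that subgroup, so
  its identity morphism would vanish.
\<close>

lemma degrees_of_generators_generate:
  assumes faithful: "\<And>u. u \<in> carrier U \<Longrightarrow> \<exists>X\<in>c u. \<not> zero_object C X"
    and degree: "\<And>i. i \<in> I \<Longrightarrow> g i \<in> carrier U \<and> X i \<in> c (g i)"
    and gen: "fusion_generated C (X ` I) = Obj C"
  shows "generate U (g ` I) = carrier U"
proof -
  let ?H = "generate U (g ` I)"
  have H: "subgroup ?H U"
    using degree by (intro U.generate_is_subgroup) auto
  have "X i \<in> supported ?H" if "i \<in> I" for i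
    using component_subset_supported[OF subgroup.subset[OF H], of "g i"] degree[OF that]
      generate.incl[of "g i" "g ` I" U] that by blast
  then have all: "Obj C \<subseteq> supported ?H"
    using hull_minimal[of "X ` I" "supported ?H" "fusion_subcategory C"]
      fusion_subcategory_supported[OF H] gen by (auto simp: fusion_generated_def)
  have "u \<in> ?H" if u: "u \<in> carrier U" for u
  proof (rule ccontr)
    assume "u \<notin> ?H"
    obtain Y where Y: "Y \<in> c u" "\<not> zero_object C Y"
      using faithful[OF u] by blast
    then have YO: "Y \<in> Obj C"
      using component_Obj[of u] u by simp
    then have "mor C Y Y = {\<zero>\<^bsub>Hom C Y Y\<^esub>}"
      using all Y(1) u \<open>u \<notin> ?H\<close> unfolding supported_def by blast
    then show False
      using Id_mor[OF YO] YO Y(2) by (simp add: zero_object_def)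
  qed
  then show ?thesis
    using subgroup.subset[OF H] by blast
qed

end

section \<open>The universal grading group\<close>

theorem theorem4p1:
  fixes K :: "'k ring" and C :: "('o, 'm, 'k) monoidal_data"
    and U :: "'u monoid" and c :: "'u \<Rightarrow> 'o set"
  assumes "algebraically_closed K" and "char_zero K"
    and "fusion_category K C"
    and "universal_grading C U c"
  shows "(\<forall>X g. simple_object C X \<and> g \<in> carrier U \<and> X \<in> c g \<longrightarrow>
            group.ord U g dvd object_order C X) \<and>
         (\<forall>m (X :: nat \<Rightarrow> 'o) (g :: nat \<Rightarrow> 'u).
            (\<forall>i\<in>{1..m}. simple_object C (X i) \<and> g i \<in> carrier U \<and> X i \<in> c (g i)) \<and>
            fusion_generated C (X ` {1..m}) = Obj C \<longrightarrow>
            generate U (g ` {1..m}) = carrier U) \<and>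
         (\<forall>X. simple_object C X \<and> faithful_object C X \<longrightarrow>
            cyclic_group U \<and> order U dvd object_order C X)"
proof -
  have grading: "grading C U c"
    and faithful: "\<exists>X\<in>c u. \<not> zero_object C X" if "u \<in> carrier U" for u
    using assms(4) that by (auto simp: universal_grading_def faithful_grading_def)
  have "graded_fusion_category K C U c"
    using assms(3,4)
    by (simp add: graded_fusion_category_def graded_fusion_category_axioms_def
        universal_grading_def faithful_grading_def)
  then interpret graded_fusion_category K C U c .
  have cyclic: "cyclic_group U \<and> order U dvd object_order C X"
    if X: "simple_object C X" "faithful_object C X" for X
  proof -
    obtain g where g: "g \<in> carrier U" "X \<in> c g"
      using simple_object_homogeneous[OF X(1)] .
    have gen: "generate U {g} = carrier U"
      using degrees_of_generators_generate[of "{()}" "\<lambda>_. g" "\<lambda>_. X"] faithful g X(2)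
      by (simp add: faithful_object_def)
    then have "cyclic_group U"
      using U.cyclic_group U.generate_pow[OF g(1)] g(1) by (auto simp: full_SetCompr_eq)
    moreover have "order U = U.ord g"
      using U.generate_pow_card[OF g(1)] gen by (simp add: order_def)
    ultimately show ?thesis
      using ord_degree_dvd_object_order[OF g] by simp
  qed
  show ?thesis
  proof (intro conjI allI impI)
    fix X g
    assume "simple_object C X \<and> g \<in> carrier U \<and> X \<in> c g"
    then show "U.ord g dvd object_order C X"
      by (intro ord_degree_dvd_object_order) simp_all
  next
    fix m and X :: "nat \<Rightarrow> 'o" and g :: "nat \<Rightarrow> 'u"
    assume asm: "(\<forall>i\<in>{1..m}. simple_object C (X i) \<and> g i \<in> carrier U \<and> X i \<in> c (g i)) \<and>
      fusion_generated C (X ` {1..m}) = Obj C"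
    show "generate U (g ` {1..m}) = carrier U"
    proof (rule degrees_of_generators_generate[OF faithful])
      show "g i \<in> carrier U \<and> X i \<in> c (g i)" if "i \<in> {1..m}" for i
        using bspec[OF conjunct1[OF asm] that] by simp
    qed (use asm in simp_all)
  next
    fix X
    assume X: "simple_object C X \<and> faithful_object C X"
    show "cyclic_group U"
      by (rule conjunct1[OF cyclic[OF conjunct1[OF X] conjunct2[OF X]]])
    show "order U dvd object_order C X"
      by (rule conjunct2[OF cyclic[OF conjunct1[OF X] conjunct2[OF X]]])
  qed
qed

end
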